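(* Let $G$ be an elementary abelian $2$-group of rank $n$, and let $M=(M_{x,y})_{x,y\in G}$ be a $\{1,-1\}$-matrix with rows and columns indexed by $G$ such that for all $x,y,z\in G$ with $x\neq y$, \[ M_{x,xz}\,M_{x,yz}\,M_{y,xz}\,M_{y,yz}=-1 .\] Let $C_2=\langle h\rangle$ be the group of order $2$, let $H=C_2\times G$, and let $\sigma_{(s,t)},\sigma'_{(s,t)}$ ($(s,t)\in H$) be the $4|G|\times 4|G|$ matrices constructed from $G$ and $M$ as in the context. Then \[ S:=\{\sigma_{(1,1)},\sigma_{(1,1)}'\}\cup\{\sigma_{(1,t)} : t\in G,\ t\neq 1\}\cup\{\sigma_{(h,t)},\sigma_{(h,t)}' : t\in G\}\] is a Jordan scheme.
   Context: Jordan product: for square matrices $A,B$ of the same order, $A*B:=\frac{1}{2}(AB+BA)$. Jordan scheme: let $X$ be a finite set and let $S=\{A_0=I,A_1,\dots,A_d\}\subset M_X(\mathbb{C})$ be a set of symmetric $\{0,1\}$-matrices with rows and columns indexed by $X$, where $I$ is the identity matrix. $S$ (or the pair $(X,S)$) is a Jordan scheme if (1) $\sum_{i=0}^d A_i=J$, the all-one matrix, and (2) for all $i,j,k\in\{0,\dots,d\}$ there exist $p_{ij}^k\in\frac12\mathbb{Z}$ such that $A_i*A_j=\sum_{k=0}^d p_{ij}^kA_k$ for all $i,j$. Construction: let $I_2$ and $J_2$ be the identity matrix and the all-one matrix of order $2$, and $K_2=J_2-I_2$. Let $E_{(s,t),(u,v)}$ denote the matrix unit in $M_H(\mathbb{C})$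 for $(s,t),(u,v)\in H$. For $(s,t)\in H=C_2\times G$ and $x,y\in G$ put \[ L_{x,y}=L^{(s,t)}_{x,y}:=\begin{cases} I_2 & \text{if } s=1,\ t=1,\\ J_2 & \text{if } s=1,\ t\neq 1,\\ I_2 & \text{if } s\neq 1 \text{ and } M_{x,y}=1,\\ K_2 & \text{if } s\neq 1\text{ and } M_{x,y}=-1,\end{cases}\] \[\sigma_{(s,t)}:=\sum_{g\in G}E_{(1,g),(s,gt)}\otimes L_{g,gt}+\sum_{g\in G}E_{(h,g),(hs,gt)}\otimes L_{gt,g},\] and \[\sigma'_{(s,t)}:=\sum_{g\in G}E_{(1,g),(s,gt)}\otimes L_{g,gt}K_2+\sum_{g\in G}E_{(h,g),(hs,gt)}\otimes L_{gt,g}K_2 .\] Note that $\sigma_{(1,t)}=\sigma'_{(1,t)}$ for $t\neq1$. The underlying set is $X=H\times\{1,2\}$, of size $4|G|$. *)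

theory Defs
  imports Complex_Main "HOL-Algebra.Product_Groups" "HOL-Library.Function_Algebras"
begin

text \<open>
  A matrix in \<open>M_X(\<complex>)\<close>, for a finite set \<open>X\<close>, is a function \<open>'x \<Rightarrow> 'x \<Rightarrow> complex\<close> that
  vanishes outside \<open>X \<times> X\<close>, so that equality of matrices is equality of functions.
  Sums and differences of matrices are the pointwise ones from \<open>Function_Algebras\<close>; note that the
  pointwise \<open>*\<close> and \<open>1\<close> of that theory are not the matrix product and the identity matrix.
\<close>

type_synonym 'x cmat = "'x \<Rightarrow> 'x \<Rightarrow> complex"

definition mats :: "'x set \<Rightarrow> 'x cmat set" where
  "mats X = {A. \<forall>x y. x \<notin> X \<or> y \<notin> X \<longrightarrow> A x y = 0}"

definition id_mat :: "'x set \<Rightarrow> 'x cmat" where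
  "id_mat X = (\<lambda>x y. if x \<in> X \<and> x = y then 1 else 0)"

definition all_one_mat :: "'x set \<Rightarrow> 'x cmat" where
  "all_one_mat X = (\<lambda>x y. if x \<in> X \<and> y \<in> X then 1 else 0)"

definition mat_unit :: "'x \<Rightarrow> 'x \<Rightarrow> 'x cmat" where
  "mat_unit a b = (\<lambda>x y. if x = a \<and> y = b then 1 else 0)"

definition mat_smult :: "complex \<Rightarrow> 'x cmat \<Rightarrow> 'x cmat" where
  "mat_smult c A = (\<lambda>x y. c * A x y)"

definition mat_prod :: "'x set \<Rightarrow> 'x cmat \<Rightarrow> 'x cmat \<Rightarrow> 'x cmat" where
  "mat_prod X A B = (\<lambda>x y. \<Sum>z\<in>X. A x z * B z y)"

definition kron :: "'x cmat \<Rightarrow> 'y cmat \<Rightarrow> ('x \<times> 'y) cmat" where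
  "kron A B = (\<lambda>(x, i) (y, j). A x y * B i j)"

definition jordan_prod :: "'x set \<Rightarrow> 'x cmat \<Rightarrow> 'x cmat \<Rightarrow> 'x cmat" where
  "jordan_prod X A B = mat_smult (1/2) (mat_prod X A B + mat_prod X B A)"

definition half_ints :: "complex set" where
  "half_ints = {of_int m / 2 | m :: int. True}"

text \<open>The matrices of \<open>S\<close> serve as their own indices: \<open>p A B C\<close> is the structure constant
  \<open>p\<^sub>i\<^sub>j\<^sup>k\<close> for \<open>A = A\<^sub>i\<close>, \<open>B = A\<^sub>j\<close>, \<open>C = A\<^sub>k\<close>.\<close>

definition jordan_scheme :: "'x set \<Rightarrow> 'x cmat set \<Rightarrow> bool" where
  "jordan_scheme X S \<longleftrightarrow>
     finite X \<and> finite S \<and> S \<subseteq> mats X \<and> id_mat X \<in> S \<and>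
     (\<forall>A\<in>S. \<forall>x\<in>X. \<forall>y\<in>X. A x y \<in> {0, 1} \<and> A x y = A y x) \<and>
     (\<Sum>A\<in>S. A) = all_one_mat X \<and>
     (\<exists>p. (\<forall>A\<in>S. \<forall>B\<in>S. \<forall>C\<in>S. p A B C \<in> half_ints) \<and>
          (\<forall>A\<in>S. \<forall>B\<in>S. jordan_prod X A B = (\<Sum>C\<in>S. mat_smult (p A B C) C)))"

definition elementary_abelian_2_group :: "('g, 'm) monoid_scheme \<Rightarrow> nat \<Rightarrow> bool" where
  "elementary_abelian_2_group G n \<longleftrightarrow>
     group G \<and> G \<cong> product_group {..<n} (\<lambda>_. integer_mod_group 2)"

definition I2 :: "nat cmat" where "I2 = id_mat {1, 2}"
definition J2 :: "nat cmat" where "J2 = all_one_mat {1, 2}"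
definition K2 :: "nat cmat" where "K2 = J2 - I2"

text \<open>In the following, \<open>C\<close> is the group \<open>C\<^sub>2 = \<langle>h\<rangle>\<close>; the group \<open>H = C\<^sub>2 \<times> G\<close> is \<open>C \<times>\<times> G\<close>.\<close>

definition Lmat :: "('c, 'k) monoid_scheme \<Rightarrow> ('g, 'm) monoid_scheme \<Rightarrow> ('g \<Rightarrow> 'g \<Rightarrow> int)
    \<Rightarrow> 'c \<times> 'g \<Rightarrow> 'g \<Rightarrow> 'g \<Rightarrow> nat cmat" where
  "Lmat C G M = (\<lambda>(s, t) x y.
     if s = \<one>\<^bsub>C\<^esub> \<and> t = \<one>\<^bsub>G\<^esub> then I2
     else if s = \<one>\<^bsub>C\<^esub> then J2
     else if M x y = 1 then I2
     else K2)"

definition sigma :: "('c, 'k) monoid_scheme \<Rightarrow> 'c \<Rightarrow> ('g, 'm) monoid_scheme \<Rightarrow> ('g \<Rightarrow> 'g \<Rightarrow> int)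
    \<Rightarrow> 'c \<times> 'g \<Rightarrow> (('c \<times> 'g) \<times> nat) cmat" where
  "sigma C h G M = (\<lambda>(s, t).
     (\<Sum>g\<in>carrier G. kron (mat_unit (\<one>\<^bsub>C\<^esub>, g) (s, g \<otimes>\<^bsub>G\<^esub> t))
                         (Lmat C G M (s, t) g (g \<otimes>\<^bsub>G\<^esub> t)))
   + (\<Sum>g\<in>carrier G. kron (mat_unit (h, g) (h \<otimes>\<^bsub>C\<^esub> s, g \<otimes>\<^bsub>G\<^esub> t))
                         (Lmat C G M (s, t) (g \<otimes>\<^bsub>G\<^esub> t) g)))"

definition sigma' :: "('c, 'k) monoid_scheme \<Rightarrow> 'c \<Rightarrow> ('g, 'm) monoid_scheme \<Rightarrow> ('g \<Rightarrow> 'g \<Rightarrow> int)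
    \<Rightarrow> 'c \<times> 'g \<Rightarrow> (('c \<times> 'g) \<times> nat) cmat" where
  "sigma' C h G M = (\<lambda>(s, t).
     (\<Sum>g\<in>carrier G. kron (mat_unit (\<one>\<^bsub>C\<^esub>, g) (s, g \<otimes>\<^bsub>G\<^esub> t))
                         (mat_prod {1, 2} (Lmat C G M (s, t) g (g \<otimes>\<^bsub>G\<^esub> t)) K2))
   + (\<Sum>g\<in>carrier G. kron (mat_unit (h, g) (h \<otimes>\<^bsub>C\<^esub> s, g \<otimes>\<^bsub>G\<^esub> t))
                         (mat_prod {1, 2} (Lmat C G M (s, t) (g \<otimes>\<^bsub>G\<^esub> t) g) K2)))"

end

theory Submission
  imports Defs
begin

text \<open>
  The matrices in question are the colour classes of a symmetric edge colouring of
  \<open>X = (C \<times> G) \<times> {1, 2}\<close>. A pair of points \<open>((a, x), i)\<close>, \<open>((b, y), j)\<close> on the same side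
  (\<open>a = b\<close>) is diagonal, a flip (\<open>x = y\<close>, \<open>i \<noteq> j\<close>) or is coloured by \<open>x y \<noteq> 1\<close>. A pair on opposite
  sides is coloured by \<open>x y\<close> together with a bit: whether the sign of the relevant entry of \<open>M\<close>
  agrees with the sign that is positive exactly if \<open>i = j\<close>. The entry of the Jordan product of two
  classes at \<open>(p, q)\<close> is half the number of two-step walks from \<open>p\<close> to \<open>q\<close> and from \<open>q\<close> to \<open>p\<close>
  that use the two colours in the given order. So the half-integrality of the structure constants is
  automatic, and it remains to show that this number depends only on the colour of \<open>(p, q)\<close>
  (\<open>jordan_scheme_color_classes\<close>).

  If one of the two colours joins points of the same side, the numbers of walks from \<open>p\<close> to \<open>q\<close> and
  from \<open>q\<close> to \<open>p\<close> are each determined by the colour (\<open>walks_non_Crs\<close>). The signs of \<open>M\<close> matter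
  only for two crossing colours with group elements \<open>t\<close> and \<open>u\<close>. A crossing colour determines the
  next point of a walk, so there is at most one walk in either direction, and none unless
  \<open>p = ((a, x), i)\<close> and \<open>q = ((a, y), j)\<close> are on the same side and \<open>x y = t u\<close>. Then the walk from
  \<open>p\<close> runs over \<open>x t\<close> and the one from \<open>q\<close> over \<open>y t = x u\<close>. Whether either walk closes up with the
  prescribed bits is decided by a product of two entries of \<open>M\<close>, and for \<open>x \<noteq> y\<close> the four entries
  form one of the rectangles of \<open>M\<close> whose product is \<open>-1\<close>. Hence exactly one of the two walks exists
  (\<open>pos_rectangle\<close>, \<open>walks_Crs_Crs_symmetrized\<close>). The ordinary product of the two classes may
  distinguish pairs of the same colour; only the symmetrized count is constant, which is why the
  result is a Jordan scheme.
\<close>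

section \<open>Jordan schemes from edge colourings\<close>

definition color_class :: "'x set \<Rightarrow> ('x \<Rightarrow> 'x \<Rightarrow> 'i) \<Rightarrow> 'i \<Rightarrow> 'x cmat" where
  "color_class X col c = (\<lambda>x y. if x \<in> X \<and> y \<in> X \<and> col x y = c then 1 else 0)"

text \<open>The sum over an indicator, rather than a cardinality, matches the entries of a matrix product and
  lets the count be restricted to the possible middle points.\<close>

definition walks :: "'x set \<Rightarrow> ('x \<Rightarrow> 'x \<Rightarrow> 'i) \<Rightarrow> 'i \<Rightarrow> 'i \<Rightarrow> 'x \<Rightarrow> 'x \<Rightarrow> nat" where
  "walks X col c d x y = (\<Sum>z\<in>X. of_bool (col x z = c \<and> col z y = d))"

lemma sum_fun_apply: "(\<Sum>i\<in>A. f i) x = (\<Sum>i\<in>A. f i x)"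
  by (induction A rule: infinite_finite_induct) auto

lemma mat_prod_color_class:
  assumes "x \<in> X" "y \<in> X"
  shows "mat_prod X (color_class X col c) (color_class X col d) x y = of_nat (walks X col c d x y)"
  unfolding mat_prod_def color_class_def walks_def of_nat_sum
  by (rule sum.cong) (use assms in auto)

lemma walks_reverse:
  assumes "\<And>u v. u \<in> X \<Longrightarrow> v \<in> X \<Longrightarrow> col u v = col v u" "x \<in> X" "y \<in> X"
  shows "walks X col c d x y = walks X col d c y x"
  unfolding walks_def using assms by (intro sum.cong) (auto simp: assms(1))

lemma jordan_prod_color_class:
  assumes "\<And>u v. u \<in> X \<Longrightarrow> v \<in> X \<Longrightarrow> col u v = col v u" "x \<in> X" "y \<in> X"
  shows "jordan_prod X (color_class X col c) (color_class X col d) x y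
         = of_nat (walks X col c d x y + walks X col c d y x) / 2"
  using assms
  by (simp add: jordan_prod_def mat_smult_def mat_prod_color_class walks_reverse[of X col x y d c])

text \<open>The classes of a symmetric colouring have disjoint supports covering all pairs, so a matrix lies in
  their span exactly if it is constant on each of them, and its coefficients are then its values.
  For a Jordan product these values are half a number of walks.\<close>

lemma jordan_scheme_color_classes:
  assumes fin: "finite X" "finite I"
    and sym: "\<And>x y. x \<in> X \<Longrightarrow> y \<in> X \<Longrightarrow> col x y = col y x"
    and diag: "\<And>x y. x \<in> X \<Longrightarrow> y \<in> X \<Longrightarrow> col x y = c\<^sub>0 \<longleftrightarrow> x = y" "c\<^sub>0 \<in> I"
    and range: "\<And>x y. x \<in> X \<Longrightarrow> y \<in> X \<Longrightarrow> col x y \<in> I"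
    and walks: "\<And>c d x y x' y'. c \<in> I \<Longrightarrow> d \<in> I \<Longrightarrow> x \<in> X \<Longrightarrow> y \<in> X \<Longrightarrow> x' \<in> X \<Longrightarrow> y' \<in> X \<Longrightarrow>
      col x y = col x' y' \<Longrightarrow>
      walks X col c d x y + walks X col c d y x = walks X col c d x' y' + walks X col c d y' x'"
  shows "jordan_scheme X (color_class X col ` I)"
proof -
  let ?cl = "color_class X col"
  let ?S = "?cl ` I"
  have entry: "A x y = of_bool (A = ?cl (col x y))" if "A \<in> ?S" "x \<in> X" "y \<in> X" for A x y
    using that by (auto simp: color_class_def fun_eq_iff)
  have sum_entry: "(\<Sum>A\<in>?S. f A * A x y) = f (?cl (col x y))" if "x \<in> X" "y \<in> X" for f x y
  proof -
    have "(\<Sum>A\<in>?S. f A * A x y) = (\<Sum>A\<in>?S. if A = ?cl (col x y) then f A else 0)"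
      by (intro sum.cong refl) (subst entry[OF _ that], assumption, simp)
    then show ?thesis using fin range[OF that] by (simp add: sum.delta)
  qed
  have outside: "A x y = 0" if "A \<in> ?S" "x \<notin> X \<or> y \<notin> X" for A x y
    using that by (auto simp: color_class_def)
  have mats: "?S \<subseteq> mats X" by (auto simp: mats_def color_class_def)
  have "id_mat X = ?cl c\<^sub>0"
    using diag by (auto simp: id_mat_def color_class_def fun_eq_iff)
  then have one: "id_mat X \<in> ?S" using diag by blast
  have total: "(\<Sum>A\<in>?S. A) = all_one_mat X"
  proof (intro ext)
    fix x y show "(\<Sum>A\<in>?S. A) x y = all_one_mat X x y"
      using sum_entry[of x y "\<lambda>_. 1"] outside[of _ x y]
      by (cases "x \<in> X \<and> y \<in> X") (auto simp: sum_fun_apply all_one_mat_def intro!: sum.neutral)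
  qed
  (* The structure constant is read off at an arbitrary pair in the support of D. The class of a
     colour that does not occur is the zero matrix and gets coefficient 0. *)
  define p where "p A B D = (if \<exists>x\<in>X. \<exists>y\<in>X. D = ?cl (col x y)
      then (let (x, y) = SOME (x, y). x \<in> X \<and> y \<in> X \<and> D = ?cl (col x y) in jordan_prod X A B x y)
      else 0)" for A B D
  have p_eq: "p A B (?cl (col x y)) = jordan_prod X A B x y"
    if AB: "A \<in> ?S" "B \<in> ?S" and xy: "x \<in> X" "y \<in> X" for A B x y
  proof -
    obtain c d where cd: "c \<in> I" "A = ?cl c" "d \<in> I" "B = ?cl d" using AB by blast
    obtain x' y' where e: "(SOME (u, v). u \<in> X \<and> v \<in> X \<and> ?cl (col x y) = ?cl (col u v)) = (x', y')"
      by (meson surj_pair)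
    have "case (x', y') of (u, v) \<Rightarrow> u \<in> X \<and> v \<in> X \<and> ?cl (col x y) = ?cl (col u v)"
      unfolding e[symmetric] by (rule someI[of _ "(x, y)"]) (use xy in auto)
    then have s: "x' \<in> X" "y' \<in> X" "?cl (col x y) = ?cl (col x' y')" by auto
    from s(3) have "?cl (col x y) x y = ?cl (col x' y') x y" by simp
    with xy have c: "col x y = col x' y'" by (auto simp: color_class_def split: if_splits)
    have "p A B (?cl (col x y)) = jordan_prod X A B x' y'"
      unfolding p_def e using xy by auto
    also have "\<dots> = jordan_prod X A B x y"
      unfolding cd using cd s xy walks[OF cd(1,3) xy s(1,2) c]
      by (simp add: jordan_prod_color_class[OF sym])
    finally show ?thesis .
  qed
  have half: "p A B D \<in> half_ints" if AB: "A \<in> ?S" "B \<in> ?S" for A B D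
  proof (cases "\<exists>x\<in>X. \<exists>y\<in>X. D = ?cl (col x y)")
    case True
    then obtain x y where xy: "x \<in> X" "y \<in> X" "D = ?cl (col x y)" by blast
    obtain c d where "A = ?cl c" "B = ?cl d" using AB by blast
    with p_eq[OF AB xy(1,2)] xy have
      "p A B D = of_int (int (walks X col c d x y + walks X col c d y x)) / 2"
      by (simp only: jordan_prod_color_class[OF sym] of_int_of_nat_eq)
    then show ?thesis unfolding half_ints_def by blast
  next
    case False
    then have "p A B D = of_int 0 / 2" unfolding p_def by simp
    then show ?thesis unfolding half_ints_def by blast
  qed
  have expand: "jordan_prod X A B = (\<Sum>D\<in>?S. mat_smult (p A B D) D)"
    if AB: "A \<in> ?S" "B \<in> ?S" for A B
  proof (intro ext)
    fix x y
    show "jordan_prod X A B x y = (\<Sum>D\<in>?S. mat_smult (p A B D) D) x y"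
    proof (cases "x \<in> X \<and> y \<in> X")
      case True
      then show ?thesis
        using sum_entry[of x y "p A B"] p_eq[OF AB, of x y] by (simp add: sum_fun_apply mat_smult_def)
    next
      case False
      then have "A x z * B z y = 0" "B x z * A z y = 0" for z
        using outside[OF AB(1), of x z] outside[OF AB(2), of z y]
          outside[OF AB(2), of x z] outside[OF AB(1), of z y] by (metis mult_eq_0_iff)+
      then have "jordan_prod X A B x y = 0"
        by (simp only: jordan_prod_def mat_smult_def mat_prod_def plus_fun_apply sum.neutral_const)
          simp
      moreover have "(\<Sum>D\<in>?S. mat_smult (p A B D) D) x y = 0"
        unfolding sum_fun_apply mat_smult_def using False outside[of _ x y] by (simp add: sum.neutral)
      ultimately show ?thesis by simp
    qed
  qed
  have entries: "\<forall>A\<in>?S. \<forall>x\<in>X. \<forall>y\<in>X. A x y \<in> {0, 1} \<and> A x y = A y x"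
    by (auto simp: color_class_def sym)
  show ?thesis
    unfolding jordan_scheme_def
  proof (intro conjI exI[of _ p])
    show "finite ?S" using fin by simp
    show "\<forall>A\<in>?S. \<forall>B\<in>?S. \<forall>D\<in>?S. p A B D \<in> half_ints"
      by (intro ballI half)
    show "\<forall>A\<in>?S. \<forall>B\<in>?S. jordan_prod X A B = (\<Sum>D\<in>?S. mat_smult (p A B D) D)"
      by (intro ballI expand)
  qed (fact fin mats one entries total)+
qed

section \<open>The groups\<close>

lemma elementary_abelian_2_group_finite:
  assumes "elementary_abelian_2_group G n"
  shows "finite (carrier G)"
proof -
  from assms obtain f where "f \<in> iso G (product_group {..<n} (\<lambda>_. integer_mod_group 2))"
    unfolding elementary_abelian_2_group_def is_iso_def by blast
  then have "bij_betw f (carrier G) (carrier (product_group {..<n} (\<lambda>_. integer_mod_group 2)))"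
    by (simp add: iso_def)
  moreover have "finite (carrier (product_group {..<n} (\<lambda>_. integer_mod_group 2)))"
    by (auto simp: carrier_integer_mod_group intro!: finite_PiE)
  ultimately show ?thesis using bij_betw_finite by blast
qed

lemma elementary_abelian_2_group_square:
  assumes G: "elementary_abelian_2_group G n" and x: "x \<in> carrier G"
  shows "x \<otimes>\<^bsub>G\<^esub> x = \<one>\<^bsub>G\<^esub>"
proof -
  let ?P = "product_group {..<n} (\<lambda>_. integer_mod_group 2)"
  interpret G: group G using G by (simp add: elementary_abelian_2_group_def)
  interpret P: group ?P by simp
  from G obtain f where f: "f \<in> iso G ?P"
    unfolding elementary_abelian_2_group_def is_iso_def by blast
  then have hom: "f \<in> hom G ?P" and inj: "inj_on f (carrier G)"
    by (auto simp: iso_iff)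
  have sq: "u \<otimes>\<^bsub>?P\<^esub> u = \<one>\<^bsub>?P\<^esub>" if "u \<in> carrier ?P" for u
    using that by (auto simp: fun_eq_iff restrict_def)
  have "f (x \<otimes>\<^bsub>G\<^esub> x) = f x \<otimes>\<^bsub>?P\<^esub> f x" by (rule hom_mult[OF hom x x])
  also have "\<dots> = \<one>\<^bsub>?P\<^esub>" by (rule sq) (use hom x in \<open>rule hom_in_carrier\<close>)
  also have "\<dots> = f \<one>\<^bsub>G\<^esub>"
    using hom_one[OF hom G.is_group P.is_group] by simp
  finally show ?thesis using inj x by (auto dest: inj_onD)
qed

lemma (in group) comm_group_if_squares_trivial:
  assumes "\<And>x. x \<in> carrier G \<Longrightarrow> x \<otimes> x = \<one>"
  shows "comm_group G"
proof (rule group_comm_groupI)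
  fix x y assume xy: "x \<in> carrier G" "y \<in> carrier G"
  have "inv u = u" if "u \<in> carrier G" for u using assms that inv_equality by blast
  with inv_mult_group[OF xy] xy show "x \<otimes> y = y \<otimes> x" by simp
qed

lemma (in group) order_two_generator:
  assumes "order G = 2" "h \<in> carrier G" "carrier G = generate G {h}"
  shows "h \<noteq> \<one>" "carrier G = {\<one>, h}" "h \<otimes> h = \<one>"
proof -
  show h: "h \<noteq> \<one>"
  proof
    assume "h = \<one>"
    then have "carrier G = {\<one>}" using assms generate_one by simp
    with assms(1) show False by (simp add: order_def)
  qed
  have "finite (carrier G)" using assms(1) by (metis order_def card.infinite zero_neq_numeral)
  then show C: "carrier G = {\<one>, h}"
    using assms h by (intro card_seteq[symmetric]) (auto simp: order_def)
  have "h \<otimes> h \<in> {\<one>, h}" using m_closed[OF assms(2,2)] C by simp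
  moreover have "h \<otimes> h \<noteq> h" using assms(2) h l_cancel_one by blast
  ultimately show "h \<otimes> h = \<one>" by blast
qed

section \<open>The colouring\<close>

text \<open>\<open>Diag\<close>, \<open>Flip\<close> and \<open>Par\<close> join points of the same side, \<open>Crs\<close> joins points of opposite sides.
  They are the colours of \<open>\<sigma>\<^bsub>(1,1)\<^esub>\<close>, \<open>\<sigma>'\<^bsub>(1,1)\<^esub>\<close>, \<open>\<sigma>\<^bsub>(1,t)\<^esub>\<close> with \<open>t \<noteq> 1\<close>, and, by the bit,
  \<open>\<sigma>\<^bsub>(h,t)\<^esub>\<close> or \<open>\<sigma>'\<^bsub>(h,t)\<^esub>\<close>.\<close>

datatype 'g color = Diag | Flip | Par 'g | Crs 'g bool

text \<open>The groups are described by the equations that the walk counts use, so that these need not refer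
  to isomorphisms or generators.\<close>

locale doubled_sign_matrix = comm_group G + C: group C
  for G :: "('g, 'm) monoid_scheme" (structure) and C :: "('c, 'k) monoid_scheme" +
  fixes h :: 'c and M :: "'g \<Rightarrow> 'g \<Rightarrow> int"
  assumes finite_G: "finite (carrier G)"
    and square: "x \<in> carrier G \<Longrightarrow> x \<otimes> x = \<one>"
    and sign: "x \<in> carrier G \<Longrightarrow> y \<in> carrier G \<Longrightarrow> M x y \<in> {1, -1}"
    and rectangle: "x \<in> carrier G \<Longrightarrow> y \<in> carrier G \<Longrightarrow> z \<in> carrier G \<Longrightarrow> x \<noteq> y \<Longrightarrow>
        M x (x \<otimes> z) * M x (y \<otimes> z) * M y (x \<otimes> z) * M y (y \<otimes> z) = -1"
    and h: "h \<noteq> \<one>\<^bsub>C\<^esub>" and carrier_C: "carrier C = {\<one>\<^bsub>C\<^esub>, h}" and h_square: "h \<otimes>\<^bsub>C\<^esub> h = \<one>\<^bsub>C\<^esub>"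
begin

definition points :: "(('c \<times> 'g) \<times> nat) set" where
  "points = carrier (C \<times>\<times> G) \<times> {1, 2}"

text \<open>Rows of \<open>M\<close> belong to the side of \<open>\<one>\<^bsub>C\<^esub>\<close> and columns to that of \<open>h\<close>, so the entry of \<open>M\<close> between
  \<open>(a, x)\<close> and \<open>y\<close> on the opposite side is transposed if \<open>a = h\<close>. This makes the colouring
  symmetric.\<close>

definition pos :: "'c \<Rightarrow> 'g \<Rightarrow> 'g \<Rightarrow> bool" where
  "pos a x y \<longleftrightarrow> (if a = \<one>\<^bsub>C\<^esub> then M x y else M y x) = 1"

fun col :: "('c \<times> 'g) \<times> nat \<Rightarrow> ('c \<times> 'g) \<times> nat \<Rightarrow> 'g color" where
  "col ((a, x), i) ((b, y), j) =
     (if a = b then (if x = y then (if i = j then Diag else Flip) else Par (x \<otimes> y))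
      else Crs (x \<otimes> y) (pos a x y = (i = j)))"

definition colors :: "'g color set" where
  "colors = {Diag, Flip} \<union> Par ` (carrier G - {\<one>}) \<union> (\<Union>t\<in>carrier G. {Crs t True, Crs t False})"

lemma points_iff: "((a, x), i) \<in> points \<longleftrightarrow> a \<in> {\<one>\<^bsub>C\<^esub>, h} \<and> x \<in> carrier G \<and> i \<in> {1, 2}"
  by (auto simp: points_def carrier_C)

text \<open>Every element is its own inverse, so \<open>x \<otimes> y\<close> is the difference of \<open>x\<close> and \<open>y\<close>.\<close>

lemma mult_eq_iff:
  assumes "x \<in> carrier G" "y \<in> carrier G" "t \<in> carrier G"
  shows "x \<otimes> y = t \<longleftrightarrow> y = x \<otimes> t"
  using assms square by (metis l_one m_assoc)

lemma mult_eq_one_iff: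
  assumes "x \<in> carrier G" "y \<in> carrier G"
  shows "x \<otimes> y = \<one> \<longleftrightarrow> x = y"
  using mult_eq_iff[OF assms one_closed] assms by auto

lemma finite_points: "finite points"
  unfolding points_def using finite_G by (simp add: carrier_C)

lemma finite_colors: "finite colors"
  unfolding colors_def using finite_G by auto

lemma in_colors_iff:
  "Diag \<in> colors" "Flip \<in> colors"
  "Par t \<in> colors \<longleftrightarrow> t \<in> carrier G \<and> t \<noteq> \<one>"
  "Crs t r \<in> colors \<longleftrightarrow> t \<in> carrier G"
  by (cases r; auto simp: colors_def)+

lemma col_sym: "p \<in> points \<Longrightarrow> q \<in> points \<Longrightarrow> col p q = col q p"
  using h m_comm by (cases p; cases q) (auto simp: points_def carrier_C pos_def)

lemma col_Diag_iff: "p \<in> points \<Longrightarrow> q \<in> points \<Longrightarrow> col p q = Diag \<longleftrightarrow> p = q"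
  by (cases p; cases q) (auto split: if_splits)

lemma col_in_colors: "p \<in> points \<Longrightarrow> q \<in> points \<Longrightarrow> col p q \<in> colors"
  by (cases p; cases q) (auto simp: points_iff in_colors_iff mult_eq_one_iff)

text \<open>What a colour reveals about the pair. The counts of walks whose first step is \<open>Par\<close>, and of those
  with two \<open>Crs\<close> steps, are expressed in these data.\<close>

lemma col_eqD:
  assumes "((a, x), i) \<in> points" "((b, y), j) \<in> points" "((a', x'), i') \<in> points" "((b', y'), j') \<in> points"
    and "col ((a, x), i) ((b, y), j) = col ((a', x'), i') ((b', y'), j')"
  shows "a = b \<longleftrightarrow> a' = b'" "x \<otimes> y = x' \<otimes> y'"
    and "a = b \<Longrightarrow> x = y \<longleftrightarrow> x' = y'" "a = b \<Longrightarrow> x = y \<Longrightarrow> i = j \<longleftrightarrow> i' = j'"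
proof -
  have "x \<otimes> x = \<one>" "x' \<otimes> x' = \<one>" using assms(1,3) square by (auto simp: points_iff)
  with assms(5) show "a = b \<longleftrightarrow> a' = b'" "x \<otimes> y = x' \<otimes> y'"
    and "a = b \<Longrightarrow> x = y \<longleftrightarrow> x' = y'" "a = b \<Longrightarrow> x = y \<Longrightarrow> i = j \<longleftrightarrow> i' = j'"
    by (simp_all split: if_splits)
qed

section \<open>Counting walks of length two\<close>

lemma walks_neighbors:
  assumes "N \<subseteq> points" "\<And>z. z \<in> points \<Longrightarrow> col p z = c \<longleftrightarrow> z \<in> N"
  shows "walks points col c d p q = (\<Sum>z\<in>N. of_bool (col z q = d))"
  unfolding walks_def
  by (rule sum.mono_neutral_cong_right) (use assms finite_points in auto)

lemma walks_Diag:
  assumes "p \<in> points"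
  shows "walks points col Diag d p q = of_bool (col p q = d)"
proof -
  have "walks points col Diag d p q = (\<Sum>z\<in>{p}. of_bool (col z q = d))"
    by (rule walks_neighbors) (use assms col_Diag_iff in auto)
  then show ?thesis by simp
qed

text \<open>The only middle point is the twin of \<open>p\<close>, and replacing \<open>p\<close> by its twin changes the colour of
  \<open>(p, q)\<close> by a fixed permutation of the colours.\<close>

lemma walks_Flip:
  assumes "p \<in> points" "q \<in> points" "p' \<in> points" "q' \<in> points" and "col p q = col p' q'"
  shows "walks points col Flip d p q = walks points col Flip d p' q'"
proof -
  have formula: "walks points col Flip d p q = of_bool ((case col p q of
      Diag \<Rightarrow> Flip | Flip \<Rightarrow> Diag | Par t \<Rightarrow> Par t | Crs t s \<Rightarrow> Crs t (\<not> s)) = d)"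
    if pq: "p \<in> points" "q \<in> points" for p q
  proof -
    obtain a x i b y j where e: "p = ((a, x), i)" "q = ((b, y), j)" by (metis surj_pair)
    have "walks points col Flip d p q = (\<Sum>z\<in>{((a, x), 3 - i)}. of_bool (col z q = d))"
    proof (rule walks_neighbors)
      show "{((a, x), 3 - i)} \<subseteq> points" using pq by (auto simp: e points_iff)
      fix z assume "z \<in> points"
      moreover obtain f w k where "z = ((f, w), k)" by (metis surj_pair)
      ultimately show "(col p z = Flip) = (z \<in> {((a, x), 3 - i)})"
        using pq(1) by (auto simp: e points_iff)
    qed
    moreover have "3 - i = j \<longleftrightarrow> i \<noteq> j" using pq by (auto simp: e points_iff)
    ultimately show ?thesis by (simp add: e)
  qed
  show ?thesis using formula assms by simp
qed

text \<open>A \<open>Par t\<close> step leads to both twins at \<open>x \<otimes> t\<close>. The pairs that they form with the end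
  point have the two colours \<open>Diag\<close> and \<open>Flip\<close>, or the same colour \<open>Par\<close>, or two colours \<open>Crs\<close> that
  differ in the bit; so the signs of \<open>M\<close> cancel from the count.\<close>

lemma walks_Par:
  assumes pq: "((a, x), i) \<in> points" "((b, y), j) \<in> points" and t: "t \<in> carrier G" "t \<noteq> \<one>"
  shows "walks points col (Par t) d ((a, x), i) ((b, y), j) =
    (if a = b then if x \<otimes> y = t then of_bool (Diag = d) + of_bool (Flip = d)
                   else 2 * of_bool (Par (x \<otimes> y \<otimes> t) = d)
     else of_bool (Crs (x \<otimes> y \<otimes> t) True = d) + of_bool (Crs (x \<otimes> y \<otimes> t) False = d))"
proof -
  have xy: "x \<in> carrier G" "y \<in> carrier G" using pq by (auto simp: points_iff)
  have ne: "x \<noteq> x \<otimes> t" using xy t by (metis mult_eq_iff square)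
  have N: "walks points col (Par t) d ((a, x), i) ((b, y), j) =
      (\<Sum>z\<in>{((a, x \<otimes> t), 1), ((a, x \<otimes> t), 2)}. of_bool (col z ((b, y), j) = d))"
  proof (rule walks_neighbors)
    show "{((a, x \<otimes> t), 1), ((a, x \<otimes> t), 2)} \<subseteq> points" using pq t by (auto simp: points_iff)
    fix z assume z: "z \<in> points"
    obtain e w k where zz: "z = ((e, w), k)" by (metis surj_pair)
    show "(col ((a, x), i) z = Par t) = (z \<in> {((a, x \<otimes> t), 1), ((a, x \<otimes> t), 2)})"
      using z pq t ne mult_eq_iff[of x w t] by (auto simp: zz points_iff)
  qed
  have eq: "x \<otimes> t = y \<longleftrightarrow> x \<otimes> y = t" using mult_eq_iff xy t by metis
  have "x \<otimes> t \<otimes> y = x \<otimes> y \<otimes> t" using xy t by (simp add: m_ac)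
  then have col: "col ((a, x \<otimes> t), k) ((b, y), j) =
      (if a = b then if x \<otimes> y = t then if k = j then Diag else Flip else Par (x \<otimes> y \<otimes> t)
       else Crs (x \<otimes> y \<otimes> t) (pos a (x \<otimes> t) y = (k = j)))" for k
    using eq by simp
  have "j = 1 \<or> j = 2" using pq by (simp add: points_iff)
  moreover have twins: "(\<Sum>z\<in>{((a, x \<otimes> t), 1), ((a, x \<otimes> t), 2)}. f z) =
      f ((a, x \<otimes> t), 1) + f ((a, x \<otimes> t), 2)" for f :: "('c \<times> 'g) \<times> nat \<Rightarrow> nat"
    by simp
  ultimately show ?thesis unfolding N twins col
    by (cases "a = b"; cases "x \<otimes> y = t"; cases "pos a (x \<otimes> t) y") auto
qed

text \<open>The only middle point is on the opposite side at \<open>x \<otimes> t\<close>, and its index is forced by the bit \<open>r\<close>.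
  The index cancels from the condition that the second step has bit \<open>s\<close>: equality of truth values is
  multiplication of signs.\<close>

lemma walks_Crs_Crs:
  assumes pq: "((a, x), i) \<in> points" "((b, y), j) \<in> points" and tu: "t \<in> carrier G" "u \<in> carrier G"
  shows "walks points col (Crs t r) (Crs u s) ((a, x), i) ((b, y), j) =
    of_bool (a = b \<and> x \<otimes> y = t \<otimes> u \<and>
      ((pos a x (x \<otimes> t) = pos a y (x \<otimes> t)) = (i = j)) = (r = s))"
proof -
  have xy: "x \<in> carrier G" "y \<in> carrier G" using pq by (auto simp: points_iff)
  have ij: "i = 1 \<or> i = 2" "j = 1 \<or> j = 2" using pq by (simp_all add: points_iff)
  (* The middle point is ((a', x t), k). *)
  define a' where "a' = (if a = h then \<one>\<^bsub>C\<^esub> else h)"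
  have a': "a' \<in> {\<one>\<^bsub>C\<^esub>, h}" "a' \<noteq> a" "\<And>e. e \<in> {\<one>\<^bsub>C\<^esub>, h} \<Longrightarrow> e \<noteq> a \<longleftrightarrow> e = a'"
    using h pq by (auto simp: a'_def points_iff)
  define k where "k = (if pos a x (x \<otimes> t) = r then i else 3 - i)"
  have k: "k \<in> {1, 2}"
    unfolding k_def using ij(1) by (elim disjE) simp_all
  have k_iff: "(pos a x (x \<otimes> t) = (i = l)) = r \<longleftrightarrow> l = k" if "l \<in> {1, 2}" for l
    unfolding k_def using ij(1) that
    by (cases "pos a x (x \<otimes> t)"; cases r; elim disjE insertE; simp)
  have N: "walks points col (Crs t r) (Crs u s) ((a, x), i) ((b, y), j) =
      (\<Sum>z\<in>{((a', x \<otimes> t), k)}. of_bool (col z ((b, y), j) = Crs u s))"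
  proof (rule walks_neighbors)
    show "{((a', x \<otimes> t), k)} \<subseteq> points" using a' k xy tu by (auto simp: points_iff)
    fix z assume z: "z \<in> points"
    obtain e w l where zz: "z = ((e, w), l)" by (metis surj_pair)
    have z': "e \<in> {\<one>\<^bsub>C\<^esub>, h}" "w \<in> carrier G" "l \<in> {1, 2}" using z zz points_iff by auto
    have "(col ((a, x), i) z = Crs t r) \<longleftrightarrow> e \<noteq> a \<and> w = x \<otimes> t \<and> (pos a x w = (i = l)) = r"
      using mult_eq_iff[of x w t] xy tu z' by (auto simp: zz)
    then show "(col ((a, x), i) z = Crs t r) = (z \<in> {((a', x \<otimes> t), k)})"
      using a'(3)[OF z'(1)] k_iff[OF z'(3)] by (auto simp: zz)
  qed
  have "(i = j) = ((i = k) = (k = j))" using ij k by (elim disjE insertE; simp)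
  then have bits: "(pos a y (x \<otimes> t) = (k = j)) = s \<longleftrightarrow>
      ((pos a x (x \<otimes> t) = pos a y (x \<otimes> t)) = (i = j)) = (r = s)"
    using k_iff[OF k] by blast
  have pos: "pos a' (x \<otimes> t) y = pos a y (x \<otimes> t)"
    using a' h pq by (auto simp: pos_def points_iff)
  have same: "a' \<noteq> b \<longleftrightarrow> a = b" using a' pq by (auto simp: points_iff)
  have prod: "x \<otimes> t \<otimes> y = u \<longleftrightarrow> x \<otimes> y = t \<otimes> u"
    using mult_eq_iff[of t "x \<otimes> y" u] xy tu by (simp add: m_ac)
  have "col ((a', x \<otimes> t), k) ((b, y), j) = Crs u s \<longleftrightarrow>
      a' \<noteq> b \<and> x \<otimes> t \<otimes> y = u \<and> (pos a' (x \<otimes> t) y = (k = j)) = s"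
    by simp
  then show ?thesis unfolding N pos bits same prod by (simp del: col.simps)
qed

text \<open>The condition on \<open>M\<close> in terms of signs. On the side of \<open>h\<close> the rectangle is transposed; its rows
  are then \<open>x \<otimes> t\<close> and \<open>y \<otimes> t\<close>, and its columns \<open>x\<close> and \<open>y\<close> are again their translates by \<open>t\<close>.\<close>

lemma pos_rectangle:
  assumes "x \<in> carrier G" "y \<in> carrier G" "t \<in> carrier G" "x \<noteq> y" "a \<in> {\<one>\<^bsub>C\<^esub>, h}"
  shows "(pos a x (x \<otimes> t) = pos a y (x \<otimes> t)) \<noteq> (pos a x (y \<otimes> t) = pos a y (y \<otimes> t))"
proof -
  have main: "((M x (x \<otimes> t) = 1) = (M y (x \<otimes> t) = 1)) \<noteq> ((M x (y \<otimes> t) = 1) = (M y (y \<otimes> t) = 1))"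
    if "x \<in> carrier G" "y \<in> carrier G" "x \<noteq> y" for x y
    using rectangle[OF that(1,2) assms(3) that(3)] that assms(3)
      sign[of x "x \<otimes> t"] sign[of x "y \<otimes> t"] sign[of y "x \<otimes> t"] sign[of y "y \<otimes> t"] by auto
  show ?thesis
  proof (cases "a = \<one>\<^bsub>C\<^esub>")
    case True
    then show ?thesis using main[of x y] assms by (simp add: pos_def)
  next
    case False
    have "x \<otimes> t \<noteq> y \<otimes> t" using assms by simp
    moreover have "x \<otimes> t \<otimes> t = x" "y \<otimes> t \<otimes> t = y" using assms square by (simp_all add: m_assoc)
    ultimately show ?thesis using main[of "x \<otimes> t" "y \<otimes> t"] assms False by (auto simp: pos_def)
  qed
qed

text \<open>Let \<open>a = b\<close> and \<open>x \<otimes> y = t \<otimes> u\<close>. If \<open>x \<noteq> y\<close>, exactly one of the two walks exists, whatever the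
  signs and bits are. If \<open>x = y\<close>, the signs of \<open>M\<close> cancel in each walk, so both exist or neither does.\<close>

lemma walks_Crs_Crs_symmetrized:
  assumes pq: "((a, x), i) \<in> points" "((b, y), j) \<in> points" and tu: "t \<in> carrier G" "u \<in> carrier G"
  shows "walks points col (Crs t r) (Crs u s) ((a, x), i) ((b, y), j)
       + walks points col (Crs t r) (Crs u s) ((b, y), j) ((a, x), i) =
    (if a = b \<and> x \<otimes> y = t \<otimes> u then if x = y then 2 * of_bool ((i = j) = (r = s)) else 1 else 0)"
proof -
  have xy: "x \<in> carrier G" "y \<in> carrier G" "y \<otimes> x = x \<otimes> y" using pq m_comm by (auto simp: points_iff)
  have "(pos a x (x \<otimes> t) = pos a y (x \<otimes> t)) \<noteq> (pos a x (y \<otimes> t) = pos a y (y \<otimes> t))" if "x \<noteq> y"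
    using pos_rectangle[OF xy(1,2) tu(1) that] pq points_iff by blast
  then show ?thesis
    unfolding walks_Crs_Crs[OF pq tu] walks_Crs_Crs[OF pq(2,1) tu] using xy(3) by auto
qed

lemma walks_non_Crs:
  assumes c: "c \<in> colors" "\<And>t r. c \<noteq> Crs t r"
    and pq: "p \<in> points" "q \<in> points" "p' \<in> points" "q' \<in> points" and eq: "col p q = col p' q'"
  shows "walks points col c d p q = walks points col c d p' q'"
proof (cases c)
  case (Par t)
  then have t: "t \<in> carrier G" "t \<noteq> \<one>" using c by (auto simp: in_colors_iff)
  obtain a x i b y j a' x' i' b' y' j' where e:
    "p = ((a, x), i)" "q = ((b, y), j)" "p' = ((a', x'), i')" "q' = ((b', y'), j')"
    by (metis surj_pair)
  show ?thesis
    using col_eqD(1,2)[OF pq[unfolded e] eq[unfolded e]]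
    unfolding Par e walks_Par[OF pq(1,2)[unfolded e] t] walks_Par[OF pq(3,4)[unfolded e] t]
    by simp
next
  case Diag
  then show ?thesis using pq eq by (simp add: walks_Diag)
next
  case Flip
  then show ?thesis using walks_Flip[OF pq eq] by simp
next
  case (Crs t r)
  then show ?thesis using c(2) by blast
qed

text \<open>A walk read backwards uses the colours in the opposite order, so it is enough that one of the two
  colours joins points of the same side to reduce to the unsymmetrized statement.\<close>

lemma walks_symmetrized_cong:
  assumes c: "c \<in> colors" "d \<in> colors"
    and pq: "p \<in> points" "q \<in> points" "p' \<in> points" "q' \<in> points" and eq: "col p q = col p' q'"
  shows "walks points col c d p q + walks points col c d q p =
         walks points col c d p' q' + walks points col c d q' p'"
proof -
  have rev: "walks points col c d u v = walks points col d c v u" if "u \<in> points" "v \<in> points" for u v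
    by (rule walks_reverse[OF col_sym that])
  have eq': "col q p = col q' p'" using eq pq col_sym by metis
  consider "\<And>t r. c \<noteq> Crs t r" | "\<And>t r. d \<noteq> Crs t r" | t r u s where "c = Crs t r" "d = Crs u s"
    by metis
  then show ?thesis
  proof cases
    case 1
    show ?thesis
      using walks_non_Crs[OF c(1) 1 pq eq] walks_non_Crs[OF c(1) 1 pq(2,1,4,3) eq'] by simp
  next
    case 2
    show ?thesis
      using walks_non_Crs[OF c(2) 2 pq eq] walks_non_Crs[OF c(2) 2 pq(2,1,4,3) eq']
      by (simp add: rev pq)
  next
    case 3
    then have tu: "t \<in> carrier G" "u \<in> carrier G" using c by (auto simp: in_colors_iff)
    obtain a x i b y j a' x' i' b' y' j' where e:
      "p = ((a, x), i)" "q = ((b, y), j)" "p' = ((a', x'), i')" "q' = ((b', y'), j')"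
      by (metis surj_pair)
    show ?thesis
      using col_eqD[OF pq[unfolded e] eq[unfolded e]]
      unfolding 3 e walks_Crs_Crs_symmetrized[OF pq(1,2)[unfolded e] tu]
        walks_Crs_Crs_symmetrized[OF pq(3,4)[unfolded e] tu]
      by auto
  qed
qed

lemma jordan_scheme_colors: "jordan_scheme points (color_class points col ` colors)"
  by (rule jordan_scheme_color_classes[where c\<^sub>0 = Diag])
    (fact finite_points finite_colors col_sym col_Diag_iff in_colors_iff(1) col_in_colors
      walks_symmetrized_cong)+

section \<open>The matrices are the colour classes\<close>

lemma sum_kron_units:
  "(\<Sum>g\<in>carrier G. kron (mat_unit (e, g) (s, g \<otimes> t)) (W g)) ((a, x), i) ((b, y), j) =
     (if a = e \<and> b = s \<and> x \<in> carrier G \<and> y = x \<otimes> t then W x i j else 0)"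
proof -
  have "(\<Sum>g\<in>carrier G. kron (mat_unit (e, g) (s, g \<otimes> t)) (W g)) ((a, x), i) ((b, y), j) =
    (\<Sum>g\<in>carrier G. if g = x then (if a = e \<and> b = s \<and> y = x \<otimes> t then W x i j else 0) else 0)"
    unfolding sum_fun_apply by (rule sum.cong) (auto simp: kron_def mat_unit_def)
  then show ?thesis using finite_G by (simp add: sum.delta)
qed

lemma small_entries:
  "I2 i j = (if i \<in> {1, 2} \<and> j \<in> {1, 2} \<and> i = j then 1 else 0)"
  "J2 i j = (if i \<in> {1, 2} \<and> j \<in> {1, 2} then 1 else 0)"
  "K2 i j = (if i \<in> {1, 2} \<and> j \<in> {1, 2} \<and> i \<noteq> j then 1 else 0)"
  by (auto simp: I2_def J2_def K2_def id_mat_def all_one_mat_def)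

lemma small_products: "mat_prod {1, 2} I2 K2 = K2" "mat_prod {1, 2} K2 K2 = I2"
  by (auto simp: mat_prod_def small_entries fun_eq_iff)

lemma sigma_entry:
  "sigma C h G M (s, t) ((a, x), i) ((b, y), j) =
     (if a = \<one>\<^bsub>C\<^esub> \<and> b = s \<and> x \<in> carrier G \<and> y = x \<otimes> t
      then Lmat C G M (s, t) x (x \<otimes> t) i j else 0)
   + (if a = h \<and> b = h \<otimes>\<^bsub>C\<^esub> s \<and> x \<in> carrier G \<and> y = x \<otimes> t
      then Lmat C G M (s, t) (x \<otimes> t) x i j else 0)"
  by (simp only: sigma_def prod.case plus_fun_apply sum_kron_units)

lemma sigma'_entry:
  "sigma' C h G M (s, t) ((a, x), i) ((b, y), j) =
     (if a = \<one>\<^bsub>C\<^esub> \<and> b = s \<and> x \<in> carrier G \<and> y = x \<otimes> t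
      then mat_prod {1, 2} (Lmat C G M (s, t) x (x \<otimes> t)) K2 i j else 0)
   + (if a = h \<and> b = h \<otimes>\<^bsub>C\<^esub> s \<and> x \<in> carrier G \<and> y = x \<otimes> t
      then mat_prod {1, 2} (Lmat C G M (s, t) (x \<otimes> t) x) K2 i j else 0)"
  by (simp only: sigma'_def prod.case plus_fun_apply sum_kron_units)

lemma col_eq_iff:
  "col ((a, x), i) ((b, y), j) = Diag \<longleftrightarrow> a = b \<and> x = y \<and> i = j"
  "col ((a, x), i) ((b, y), j) = Flip \<longleftrightarrow> a = b \<and> x = y \<and> i \<noteq> j"
  "col ((a, x), i) ((b, y), j) = Par t \<longleftrightarrow> a = b \<and> x \<noteq> y \<and> x \<otimes> y = t"
  "col ((a, x), i) ((b, y), j) = Crs t r \<longleftrightarrow> a \<noteq> b \<and> x \<otimes> y = t \<and> (pos a x y = (i = j)) = r"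
  by simp_all

lemma cmat_eqI:
  fixes A B :: "(('c \<times> 'g) \<times> nat) cmat"
  assumes "\<And>a x i b y j. A ((a, x), i) ((b, y), j) = B ((a, x), i) ((b, y), j)"
  shows "A = B"
proof (intro ext)
  fix p q show "A p q = B p q" by (cases p; cases q) (auto simp: assms)
qed

lemma sigma_classes:
  shows "sigma C h G M (\<one>\<^bsub>C\<^esub>, \<one>) = color_class points col Diag"
    and "sigma' C h G M (\<one>\<^bsub>C\<^esub>, \<one>) = color_class points col Flip"
    and "t \<in> carrier G \<Longrightarrow> t \<noteq> \<one> \<Longrightarrow> sigma C h G M (\<one>\<^bsub>C\<^esub>, t) = color_class points col (Par t)"
    and "t \<in> carrier G \<Longrightarrow> sigma C h G M (h, t) = color_class points col (Crs t True)"
    and "t \<in> carrier G \<Longrightarrow> sigma' C h G M (h, t) = color_class points col (Crs t False)"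
proof -
  have h1: "h \<otimes>\<^bsub>C\<^esub> \<one>\<^bsub>C\<^esub> = h" using carrier_C by simp
  have h2: "\<one>\<^bsub>C\<^esub> \<noteq> h" using h by metis
  show "sigma C h G M (\<one>\<^bsub>C\<^esub>, \<one>) = color_class points col Diag"
    by (rule cmat_eqI) (simp add: sigma_entry h h1 h2 Lmat_def small_entries color_class_def
        points_iff col_eq_iff del: col.simps)
  show "sigma' C h G M (\<one>\<^bsub>C\<^esub>, \<one>) = color_class points col Flip"
    by (rule cmat_eqI) (simp add: sigma'_entry h h1 h2 Lmat_def small_products small_entries
        color_class_def points_iff col_eq_iff del: col.simps One_nat_def)
  have mult: "x \<in> carrier G \<and> y = x \<otimes> t \<longleftrightarrow> x \<in> carrier G \<and> y \<in> carrier G \<and> x \<otimes> y = t"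
    if "t \<in> carrier G" for x y t
    using mult_eq_iff[of x y t] that by auto
  show "sigma C h G M (\<one>\<^bsub>C\<^esub>, t) = color_class points col (Par t)" if t: "t \<in> carrier G" "t \<noteq> \<one>"
  proof (rule cmat_eqI)
    fix a b :: 'c and x y :: 'g and i j :: nat
    have "x \<otimes> y = t \<Longrightarrow> x \<in> carrier G \<Longrightarrow> x \<noteq> y" using t square by auto
    then show "sigma C h G M (\<one>\<^bsub>C\<^esub>, t) ((a, x), i) ((b, y), j)
        = color_class points col (Par t) ((a, x), i) ((b, y), j)"
      unfolding sigma_entry mult[OF t(1)] using t(2)
      by (auto simp: h h1 h2 Lmat_def small_entries color_class_def points_iff col_eq_iff
          simp del: col.simps)
  qed
  show "sigma C h G M (h, t) = color_class points col (Crs t True)" if t: "t \<in> carrier G"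
  proof (rule cmat_eqI)
    fix a b :: 'c and x y :: 'g and i j :: nat
    show "sigma C h G M (h, t) ((a, x), i) ((b, y), j)
        = color_class points col (Crs t True) ((a, x), i) ((b, y), j)"
    proof (cases "x \<in> carrier G \<and> y = x \<otimes> t")
      case True
      then show ?thesis
        using mult[OF t, of x y] h2
        by (cases "a = \<one>\<^bsub>C\<^esub>"; cases "a = h"; cases "b = \<one>\<^bsub>C\<^esub>"; cases "b = h")
          (simp_all add: sigma_entry h h1 h_square Lmat_def small_entries color_class_def
            points_iff col_eq_iff pos_def del: col.simps)
    next
      case False
      then show ?thesis
        using mult[OF t, of x y]
        by (auto simp add: sigma_entry color_class_def points_iff col_eq_iff simp del: col.simps)
    qed
  qed
  show "sigma' C h G M (h, t) = color_class points col (Crs t False)" if t: "t \<in> carrier G"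
  proof (rule cmat_eqI)
    fix a b :: 'c and x y :: 'g and i j :: nat
    show "sigma' C h G M (h, t) ((a, x), i) ((b, y), j)
        = color_class points col (Crs t False) ((a, x), i) ((b, y), j)"
    proof (cases "x \<in> carrier G \<and> y = x \<otimes> t")
      case True
      then show ?thesis
        using mult[OF t, of x y] h2
        by (cases "a = \<one>\<^bsub>C\<^esub>"; cases "a = h"; cases "b = \<one>\<^bsub>C\<^esub>"; cases "b = h")
          (simp_all add: sigma'_entry h h1 h_square Lmat_def small_products small_entries
            color_class_def points_iff col_eq_iff pos_def del: col.simps One_nat_def)
    next
      case False
      then show ?thesis
        using mult[OF t, of x y]
        by (auto simp add: sigma'_entry color_class_def points_iff col_eq_iff simp del: col.simps)
    qed
  qed
qed

lemma sigma_set: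
  "{sigma C h G M (\<one>\<^bsub>C\<^esub>, \<one>), sigma' C h G M (\<one>\<^bsub>C\<^esub>, \<one>)}
     \<union> {sigma C h G M (\<one>\<^bsub>C\<^esub>, t) | t. t \<in> carrier G \<and> t \<noteq> \<one>}
     \<union> (\<Union>t\<in>carrier G. {sigma C h G M (h, t), sigma' C h G M (h, t)})
   = color_class points col ` colors"
proof -
  have "{sigma C h G M (\<one>\<^bsub>C\<^esub>, t) | t. t \<in> carrier G \<and> t \<noteq> \<one>}
      = color_class points col ` Par ` (carrier G - {\<one>})"
    unfolding setcompr_eq_image image_image by (rule image_cong) (auto simp: sigma_classes(3))
  moreover have "(\<Union>t\<in>carrier G. {sigma C h G M (h, t), sigma' C h G M (h, t)})
      = color_class points col ` (\<Union>t\<in>carrier G. {Crs t True, Crs t False})"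
    using sigma_classes(4,5) by (simp add: image_UN)
  ultimately show ?thesis
    unfolding colors_def image_Un by (simp add: sigma_classes(1,2))
qed

end

theorem theorem3p1:
  fixes G :: "('g, 'm) monoid_scheme" and C :: "('c, 'k) monoid_scheme"
    and h :: 'c and n :: nat and M :: "'g \<Rightarrow> 'g \<Rightarrow> int"
  assumes "elementary_abelian_2_group G n"
    and "\<And>x y. x \<in> carrier G \<Longrightarrow> y \<in> carrier G \<Longrightarrow> M x y \<in> {1, -1}"
    and "\<And>x y z. x \<in> carrier G \<Longrightarrow> y \<in> carrier G \<Longrightarrow> z \<in> carrier G \<Longrightarrow> x \<noteq> y \<Longrightarrow>
           M x (x \<otimes>\<^bsub>G\<^esub> z) * M x (y \<otimes>\<^bsub>G\<^esub> z) * M y (x \<otimes>\<^bsub>G\<^esub> z) * M y (y \<otimes>\<^bsub>G\<^esub> z) = -1"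
    and "group C" and "order C = 2" and "h \<in> carrier C" and "carrier C = generate C {h}"
  shows "jordan_scheme (carrier (C \<times>\<times> G) \<times> {1, 2})
           ({sigma C h G M (\<one>\<^bsub>C\<^esub>, \<one>\<^bsub>G\<^esub>), sigma' C h G M (\<one>\<^bsub>C\<^esub>, \<one>\<^bsub>G\<^esub>)}
            \<union> {sigma C h G M (\<one>\<^bsub>C\<^esub>, t) | t. t \<in> carrier G \<and> t \<noteq> \<one>\<^bsub>G\<^esub>}
            \<union> (\<Union>t\<in>carrier G. {sigma C h G M (h, t), sigma' C h G M (h, t)}))"
proof -
  have "group G" using assms(1) by (simp add: elementary_abelian_2_group_def)
  then have comm: "comm_group G"
    using elementary_abelian_2_group_square[OF assms(1)] by (rule group.comm_group_if_squares_trivial)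
  interpret doubled_sign_matrix G C h M
    using comm assms(4) elementary_abelian_2_group_finite[OF assms(1)]
      elementary_abelian_2_group_square[OF assms(1)] assms(2,3)
      group.order_two_generator[OF assms(4-7)]
    unfolding doubled_sign_matrix_def doubled_sign_matrix_axioms_def by blast
  show ?thesis
    using jordan_scheme_colors unfolding sigma_set[symmetric] unfolding points_def .
qed

end
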